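(* Let $A\in\mathbb{R}^{m\times n}$ with $m<n$ have full row rank, and let $b\in\mathbb{R}^m$ be nonzero (and in the range of $A$). Suppose that $\mathrm{Ker}(A)$ has the $s$-spherical section property for some positive integer $s$, and that there exists a vector $\tilde{x}\in\mathbb{R}^n$ such that $\|\tilde{x}\|_0<\frac{m}{s}$ and $A\tilde{x}=b$. Then the set of optimal solutions of $$\bar{\alpha}=\inf\left\{\frac{\|x\|_1^2}{\|x\|_2^2}: Ax=b,\ x\in\mathbb{R}^n\right\}$$ is nonempty, i.e. there is $x_*\in\mathbb{R}^n$ with $Ax_*=b$ and $\|x_*\|_1^2/\|x_*\|_2^2=\bar{\alpha}$.
   Context: $\|x\|_0$ denotes the number of nonzero components of $x$; $\|x\|_1$ and $\|x\|_2$ are the usual $\ell_1$ and Euclidean norms; $\mathrm{Ker}(A)$ is the null space of $A$. Spherical section property: let $m<n$ be positive integers, let $V$ be an $(n-m)$-dimensional subspace of $\mathbb{R}^n$, and let $s$ be a positive integer. $V$ has the $s$-spherical section property if $$\inf_{v\in V\setminus\{0\}}\frac{\|v\|_1^2}{\|v\|_2^2}\ge\frac{m}{s}.$$ *)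

theory Defs
  imports "HOL-Analysis.Analysis"
begin

definition l0_norm :: "real ^ 'n \<Rightarrow> nat" where
  "l0_norm x = card {i. x $ i \<noteq> 0}"

definition l1_norm :: "real ^ 'n \<Rightarrow> real" where
  "l1_norm x = (\<Sum>i\<in>UNIV. \<bar>x $ i\<bar>)"

definition null_space :: "real ^ 'n ^ 'm \<Rightarrow> (real ^ 'n) set" where
  "null_space A = {v. A *v v = 0}"

(* norm is the Euclidean norm on real ^ 'n. At x = 0 this is 0 / 0 = 0;
   feasible A b below does not contain 0 when b is nonzero. *)
definition l1_l2_ratio :: "real ^ 'n \<Rightarrow> real" where
  "l1_l2_ratio x = (l1_norm x)\<^sup>2 / (norm x)\<^sup>2"

(* m is the codimension of V. Since dim V > 0, the infimum is over a nonempty set of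
   nonnegative reals, so the real-valued INF is the true infimum. *)
definition spherical_section :: "nat \<Rightarrow> nat \<Rightarrow> (real ^ 'n) set \<Rightarrow> bool" where
  "spherical_section m s V \<longleftrightarrow>
     0 < m \<and> m < CARD('n) \<and> 0 < s \<and> subspace V \<and> dim V = CARD('n) - m \<and>
     (INF v \<in> V - {0}. l1_l2_ratio v) \<ge> real m / real s"

definition feasible :: "real ^ 'n ^ 'm \<Rightarrow> real ^ 'm \<Rightarrow> (real ^ 'n) set" where
  "feasible A b = {x. A *v x = b}"

(* The values are bounded below by 0, so this real-valued INF is the true infimum
   whenever A x = b is solvable. *)
definition optimal_value :: "real ^ 'n ^ 'm \<Rightarrow> real ^ 'm \<Rightarrow> real" where
  "optimal_value A b = (INF x \<in> feasible A b. l1_l2_ratio x)"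

definition optimal_solutions :: "real ^ 'n ^ 'm \<Rightarrow> real ^ 'm \<Rightarrow> (real ^ 'n) set" where
  "optimal_solutions A b = {x \<in> feasible A b. l1_l2_ratio x = optimal_value A b}"

end

theory Submission
  imports Defs
begin

text \<open>
  Write \<open>\<kappa> = m / s\<close>. The spherical section property says that
  \<open>l1_norm v \<ge> sqrt \<kappa> * norm v\<close> on the kernel of \<open>A\<close>. By Cauchy--Schwarz on the support, the sparse
  point \<open>y\<close> has ratio \<open>\<rho> < \<kappa>\<close>, so every feasible \<open>x\<close> that is at least as good as \<open>y\<close> satisfies
  \<open>l1_norm x \<le> sqrt \<rho> * norm x\<close>. The strict gap between the two constants keeps such an \<open>x\<close> near \<open>y\<close>:
  as \<open>x - y\<close> lies in the kernel, the triangle inequality gives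
  \<open>sqrt \<kappa> * norm (x - y) \<le> l1_norm x + l1_norm y \<le> sqrt \<rho> * norm (x - y) + C\<close>
  with \<open>C\<close> depending only on \<open>y\<close>
  (\<open>bounded_translate_l1_sublevel\<close>). The ratio is scale invariant, so in general a minimizing sequence
  could escape to infinity along a kernel direction; the gap is what rules this out.
  The sublevel set is therefore compact, and it does not contain the origin, where alone the
  ratio is discontinuous, because \<open>b \<noteq> 0\<close>. The ratio attains its minimum there.
\<close>

lemma l1_norm_nonneg: "0 \<le> l1_norm x"
  by (simp add: l1_norm_def sum_nonneg)

lemma l1_norm_diff_le: "l1_norm (x - y) \<le> l1_norm x + l1_norm y"
  unfolding l1_norm_def sum.distrib[symmetric] by (rule sum_mono) (simp add: abs_triangle_ineq4)

lemma l1_l2_ratio_nonneg: "0 \<le> l1_l2_ratio x"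
  by (simp add: l1_l2_ratio_def)

lemma bdd_below_l1_l2_ratio: "bdd_below (l1_l2_ratio ` S)"
  by (rule bdd_belowI[of _ 0]) (auto simp: l1_l2_ratio_nonneg)

lemma l1_norm_eq_sqrt_ratio: "x \<noteq> 0 \<Longrightarrow> l1_norm x = sqrt (l1_l2_ratio x) * norm x"
  by (simp add: l1_l2_ratio_def real_sqrt_divide l1_norm_nonneg)

lemma l1_l2_ratio_le_l0_norm: "l1_l2_ratio x \<le> real (l0_norm x)"
proof -
  let ?I = "{i. x $ i \<noteq> 0}"
  have "l1_norm x = (\<Sum>i\<in>?I. \<bar>x $ i\<bar>)"
    unfolding l1_norm_def by (rule sum.mono_neutral_right) auto
  moreover have "(norm x)\<^sup>2 = (\<Sum>i\<in>?I. \<bar>x $ i\<bar>\<^sup>2)"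
  proof -
    have "(norm x)\<^sup>2 = (\<Sum>i\<in>UNIV. \<bar>x $ i\<bar>\<^sup>2)"
      by (simp add: norm_vec_def L2_set_def sum_nonneg)
    also have "\<dots> = (\<Sum>i\<in>?I. \<bar>x $ i\<bar>\<^sup>2)"
      by (rule sum.mono_neutral_right) auto
    finally show ?thesis .
  qed
  moreover have "(\<Sum>i\<in>?I. \<bar>x $ i\<bar> * 1)\<^sup>2 \<le> (\<Sum>i\<in>?I. \<bar>x $ i\<bar>\<^sup>2) * (\<Sum>i\<in>?I. 1\<^sup>2)"
    by (rule Cauchy_Schwarz_ineq_sum)
  ultimately have "(l1_norm x)\<^sup>2 \<le> real (l0_norm x) * (norm x)\<^sup>2"
    by (simp add: l0_norm_def mult.commute)
  then show ?thesis
    by (cases "x = 0") (simp_all add: l1_l2_ratio_def pos_divide_le_eq)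
qed

lemma spherical_section_l1_norm_ge:
  assumes "spherical_section m s V" "v \<in> V"
  shows "sqrt (real m / real s) * norm v \<le> l1_norm v"
proof (cases "v = 0")
  case True
  then show ?thesis by (simp add: l1_norm_nonneg)
next
  case False
  have "real m / real s \<le> (INF v \<in> V - {0}. l1_l2_ratio v)"
    using assms(1) by (simp add: spherical_section_def)
  also have "\<dots> \<le> l1_l2_ratio v"
    using assms(2) False by (intro cINF_lower bdd_below_l1_l2_ratio) auto
  finally have "sqrt (real m / real s) \<le> sqrt (l1_l2_ratio v)"
    by simp
  then have "sqrt (real m / real s) * norm v \<le> sqrt (l1_l2_ratio v) * norm v"
    by (intro mult_right_mono) auto
  with False show ?thesis
    by (simp add: l1_norm_eq_sqrt_ratio)
qed

text \<open>Leaving \<open>y\<close> along a direction of \<open>V\<close> makes the \<open>l1_norm\<close> grow at rate at least \<open>c\<close>, which the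
  constraint forbids beyond rate \<open>q < c\<close>. Only a bounded distance from \<open>y\<close> can compensate for this.\<close>

lemma bounded_translate_l1_sublevel:
  fixes V :: "(real ^ 'n) set"
  assumes V: "\<And>v. v \<in> V \<Longrightarrow> c * norm v \<le> l1_norm v" and "0 \<le> q" "q < c"
  shows "bounded {x. x - y \<in> V \<and> l1_norm x \<le> q * norm x}"
proof -
  define C where "C = (q * norm y + l1_norm y) / (c - q)"
  have "dist y x \<le> C" if "x - y \<in> V" "l1_norm x \<le> q * norm x" for x
  proof -
    have "norm x \<le> norm (x - y) + norm y"
      using norm_triangle_ineq[of "x - y" y] by simp
    then have "q * norm x \<le> q * norm (x - y) + q * norm y"
      using \<open>0 \<le> q\<close> by (metis distrib_left mult_left_mono)
    moreover have "c * norm (x - y) \<le> l1_norm x + l1_norm y"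
      using V[OF that(1)] l1_norm_diff_le[of x y] by simp
    ultimately have "norm (x - y) * (c - q) \<le> q * norm y + l1_norm y"
      using that(2) by (simp add: algebra_simps)
    then show ?thesis
      using \<open>q < c\<close> by (simp add: C_def dist_norm norm_minus_commute pos_le_divide_eq)
  qed
  then show ?thesis
    by (auto intro: boundedI simp: bounded_def)
qed

lemma continuous_on_l1_norm: "continuous_on S l1_norm"
  unfolding l1_norm_def by (intro continuous_intros)

lemma continuous_on_l1_l2_ratio: "0 \<notin> S \<Longrightarrow> continuous_on S l1_l2_ratio"
  unfolding l1_l2_ratio_def by (intro continuous_intros continuous_on_l1_norm) auto

lemma closed_feasible: "closed (feasible A b)"
  unfolding feasible_def
  by (intro closed_Collect_eq continuous_intros matrix_vector_mult_linear_continuous_on)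

text \<open>Once a single nonempty sublevel set is compact, a minimizer over it is a global one, since the
  remaining feasible points have a larger ratio than \<open>y\<close>.\<close>

lemma optimal_solutions_nonempty_if_compact_sublevel:
  assumes "b \<noteq> 0" "y \<in> feasible A b"
    and "compact {x \<in> feasible A b. l1_l2_ratio x \<le> l1_l2_ratio y}" (is "compact ?S")
  shows "optimal_solutions A b \<noteq> {}"
proof -
  have "0 \<notin> ?S"
    using assms(1) by (auto simp: feasible_def)
  then obtain z where z: "z \<in> ?S" and min: "\<And>x. x \<in> ?S \<Longrightarrow> l1_l2_ratio z \<le> l1_l2_ratio x"
    using continuous_attains_inf[OF assms(3) _ continuous_on_l1_l2_ratio] assms(2) by blast
  have "l1_l2_ratio z \<le> l1_l2_ratio x" if "x \<in> feasible A b" for x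
    using z that min[of x] by (cases "l1_l2_ratio x \<le> l1_l2_ratio y") auto
  then have "optimal_value A b = l1_l2_ratio z"
    unfolding optimal_value_def using z by (intro cInf_eq_minimum) auto
  then show ?thesis
    using z by (auto simp: optimal_solutions_def)
qed

theorem theorem1:
  fixes A :: "real ^ 'n ^ 'm" and b :: "real ^ 'm" and s :: nat
  assumes "CARD('m) < CARD('n)"
    and "rank A = CARD('m)"
    and "b \<noteq> 0"
    and "b \<in> range (\<lambda>x. A *v x)"
    and "s > 0"
    and "spherical_section CARD('m) s (null_space A)"
    and "\<exists>x. real (l0_norm x) < real CARD('m) / real s \<and> A *v x = b"
  shows "optimal_solutions A b \<noteq> {}"
proof -
  obtain y where sparse: "real (l0_norm y) < real CARD('m) / real s" and y: "A *v y = b"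
    using assms(7) by blast
  define q where "q = sqrt (l1_l2_ratio y)"
  have q: "0 \<le> q" "q < sqrt (real CARD('m) / real s)"
    using l1_l2_ratio_le_l0_norm[of y] sparse by (simp_all add: q_def l1_l2_ratio_nonneg)
  have sublevel: "{x \<in> feasible A b. l1_l2_ratio x \<le> l1_l2_ratio y}
      = feasible A b \<inter> {x. l1_norm x \<le> q * norm x}"
  proof -
    have "l1_l2_ratio x \<le> l1_l2_ratio y \<longleftrightarrow> l1_norm x \<le> q * norm x" if "x \<in> feasible A b" for x
    proof -
      have "x \<noteq> 0"
        using that \<open>b \<noteq> 0\<close> by (auto simp: feasible_def)
      then show ?thesis
        by (simp add: l1_norm_eq_sqrt_ratio q_def)
    qed
    then show ?thesis by blast
  qed
  have "closed (feasible A b \<inter> {x. l1_norm x \<le> q * norm x})"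
    by (intro closed_Int closed_feasible closed_Collect_le continuous_intros continuous_on_l1_norm)
  moreover have "bounded (feasible A b \<inter> {x. l1_norm x \<le> q * norm x})"
  proof (rule bounded_subset)
    show "bounded {x. x - y \<in> null_space A \<and> l1_norm x \<le> q * norm x}"
      using spherical_section_l1_norm_ge[OF assms(6)] q by (rule bounded_translate_l1_sublevel)
    show "feasible A b \<inter> {x. l1_norm x \<le> q * norm x}
        \<subseteq> {x. x - y \<in> null_space A \<and> l1_norm x \<le> q * norm x}"
      using y by (auto simp: feasible_def null_space_def matrix_vector_mult_diff_distrib)
  qed
  ultimately have "compact {x \<in> feasible A b. l1_l2_ratio x \<le> l1_l2_ratio y}"
    unfolding sublevel compact_eq_bounded_closed by blast
  with \<open>b \<noteq> 0\<close> show ?thesis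
    using y by (intro optimal_solutions_nonempty_if_compact_sublevel) (auto simp: feasible_def)
qed

end
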